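(* For all $f, g\in C^{2}[0, 1]$ (real-valued), all $n\in \mathbb{N}$ (i.e. $n \ge 1$) and all $x, y\in [0, 1]$ with $x\neq y$, we have $$ \begin{aligned} &\Big|K_{n}(f g)(x)-K_{n}(f)(x)\cdot K_{n}(g)(x)+(x-y)\cdot \frac{1-2x}{2(n+1)}\big([x, y; f]\cdot [x, y; g]-f^{\prime}(x)g^{\prime}(x)\big)-F_{n}(x)\cdot f^{\prime}(x)\cdot g^{\prime}(x)\Big|\\ &\le \left[\frac{1}{(n+1)^{2}}\left(x(1-x)(n-1)+ \frac13\right)+|x-y|\cdot \frac{1}{\sqrt{3}\sqrt{n+1}}\right]\\ &\quad\cdot \left[\omega_{1}\left((f g)^{\prime \prime}; |x-y|+\frac{2 \sqrt{6}}{\sqrt{n+1}}\right)+\|g\|\,\omega_{1}\left(f^{\prime \prime}; |x-y|+\frac{2 \sqrt{6}}{\sqrt{n+1}}\right)+ \|f\|\,\omega_{1}\left(g^{\prime \prime}; |x-y|+\frac{2 \sqrt{6}}{\sqrt{n+1}}\right)\right]\\ &\quad+|K_{n}(f)(x)-f(x)|\cdot |K_{n}(g)(x)-g(x)|. \end{aligned} $$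
   Context: For $f:[0,1]\to\mathbb{R}$ integrable on $[0,1]$ and $n\in\mathbb{N}$, the Bernstein-Kantorovich polynomial is $$K_{n}(f)(x)=\sum_{k=0}^{n}p_{n, k}(x)\cdot (n+1)\int_{k/(n+1)}^{(k+1)/(n+1)}f(t)\, dt,\qquad p_{n, k}(x)=\binom{n}{k}x^{k}(1-x)^{n-k},\quad x\in[0,1].$$ For $x\in[0,1]$, $$F_{n}(x)=\frac{1}{(n+1)^{2}}\left(x(1-x)(n-1) + \frac{1}{3}\right).$$ For $x\ne y$, $[x, y; f]=\frac{f(x)-f(y)}{x-y}$ is the divided difference. The modulus of continuity is $\omega_{1}(f; \delta)=\sup\{|f(u)-f(v)| : u, v\in [0, 1],\ |u-v|\le \delta\}$, and $\|f\|=\sup_{t\in[0,1]}|f(t)|$ is the uniform norm. *)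

theory Defs
  imports "HOL-Analysis.Analysis"
begin

text \<open>
  Functions on the unit interval are total functions on the reals; every notion below depends
  only on their values on \<open>{0..1}\<close>. In particular derivatives are taken within \<open>{0..1}\<close>, that is,
  they are one-sided at the endpoints.
\<close>

definition deriv01 :: "(real \<Rightarrow> real) \<Rightarrow> real \<Rightarrow> real" where
  "deriv01 f x = vector_derivative f (at x within {0..1})"

definition C2_on_01 :: "(real \<Rightarrow> real) \<Rightarrow> bool" where
  "C2_on_01 f \<longleftrightarrow>
     f differentiable_on {0..1} \<and>
     deriv01 f differentiable_on {0..1} \<and>
     continuous_on {0..1} (deriv01 (deriv01 f))"

lemma deriv01_eqI:
  assumes "(f has_real_derivative D) (at x within {0..1})" "x \<in> {0..1}"
  shows "deriv01 f x = D"
  using assms unfolding deriv01_def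
  by (intro vector_derivative_within_closed_interval)
     (auto simp: has_real_derivative_iff_has_vector_derivative)

text \<open>
  The library polynomial \<open>Bernstein n k\<close> is the basis polynomial \<open>p\<^sub>n\<^sub>,\<^sub>k\<close>.
\<close>

definition kantorovich :: "nat \<Rightarrow> (real \<Rightarrow> real) \<Rightarrow> real \<Rightarrow> real" where
  "kantorovich n f x =
     (\<Sum>k=0..n. Bernstein n k x *
        ((real n + 1) * integral {real k / (real n + 1)..(real k + 1) / (real n + 1)} f))"

definition F_kantorovich :: "nat \<Rightarrow> real \<Rightarrow> real" where
  "F_kantorovich n x = 1 / (real n + 1)^2 * (x * (1 - x) * (real n - 1) + 1 / 3)"

definition divided_difference :: "real \<Rightarrow> real \<Rightarrow> (real \<Rightarrow> real) \<Rightarrow> real" where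
  "divided_difference x y f = (f x - f y) / (x - y)"

text \<open>
  The suprema in the next two definitions are real-valued; they are meaningful for functions
  bounded on \<open>{0..1}\<close> (and \<open>\<delta> \<ge> 0\<close>).
\<close>

definition modulus_of_continuity :: "(real \<Rightarrow> real) \<Rightarrow> real \<Rightarrow> real" where
  "modulus_of_continuity f \<delta> =
     Sup {\<bar>f u - f v\<bar> | u v. u \<in> {0..1} \<and> v \<in> {0..1} \<and> \<bar>u - v\<bar> \<le> \<delta>}"

definition sup_norm01 :: "(real \<Rightarrow> real) \<Rightarrow> real" where
  "sup_norm01 f = (SUP t\<in>{0..1}. \<bar>f t\<bar>)"

end

theory Submission
  imports Defs
begin

text \<open>
  Subtracting from \<open>h\<close> the interpolant \<open>h x + (t - x) [x, y; h] + (t - x) (t - y) h'' x / 2\<close> leaves a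
  remainder which, by Rolle's theorem for second derivatives, equals
  \<open>(t - x) (t - y) (h'' \<xi> - h'' x) / 2\<close> with \<open>\<bar>\<xi> - x\<bar> \<le> \<bar>x - y\<bar> + \<bar>t - x\<bar>\<close>. Hence the error in
  \<open>K\<^sub>n h x \<approx> h x + K\<^sub>n(t - x) [x, y; h] + K\<^sub>n((t - x) (t - y)) h'' x / 2\<close>
  is controlled by the second and fourth central moments of \<open>K\<^sub>n\<close>. Using this expansion for
  \<open>f g\<close>, \<open>f\<close> and \<open>g\<close> in
  \<open>K\<^sub>n(f g) - K\<^sub>n f K\<^sub>n g = (K\<^sub>n(f g) - f g) - f (K\<^sub>n g - g) - g (K\<^sub>n f - f) - (K\<^sub>n f - f) (K\<^sub>n g - g)\<close>,
  the main terms combine to the ones in the theorem.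
\<close>

section \<open>Central moments\<close>

text \<open>Pascal's rule: a binomial variable for \<open>Suc n\<close> trials is conditioned on one
  trial, which succeeds with weight \<open>x\<close>. This drives the induction on \<open>n\<close>
  for the moments.\<close>

lemma sum_Bernstein_Suc:
  "(\<Sum>k=0..Suc n. Bernstein (Suc n) k x * \<phi> k) =
   (\<Sum>k=0..n. Bernstein n k x * (x * \<phi> (Suc k) + (1 - x) * \<phi> k))"
proof -
  have step: "Bernstein (Suc n) (Suc k) x = x * Bernstein n k x + (1 - x) * Bernstein n (Suc k) x"
    if "k \<le> n" for k
  proof (cases "k = n")
    case True
    then show ?thesis by (simp add: Bernstein_def)
  next
    case False
    then have "n - k = Suc (n - Suc k)" using that by simp
    then show ?thesis by (simp add: Bernstein_def algebra_simps)
  qed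
  have zero: "Bernstein (Suc n) 0 x = (1 - x) * Bernstein n 0 x"
    by (simp add: Bernstein_def)
  have top: "Bernstein n (Suc n) x = 0"
    by (simp add: Bernstein_def)
  have "(\<Sum>k=0..Suc n. Bernstein (Suc n) k x * \<phi> k) =
      (1 - x) * Bernstein n 0 x * \<phi> 0 + (\<Sum>k=0..n. Bernstein (Suc n) (Suc k) x * \<phi> (Suc k))"
    unfolding sum.atLeast0_atMost_Suc_shift zero by (simp add: o_def)
  also have "(\<Sum>k=0..n. Bernstein (Suc n) (Suc k) x * \<phi> (Suc k)) =
      (\<Sum>k=0..n. Bernstein n k x * (x * \<phi> (Suc k))) +
      (\<Sum>k=0..n. Bernstein n (Suc k) x * ((1 - x) * \<phi> (Suc k)))"
    by (subst sum.distrib [symmetric], rule sum.cong) (auto simp: step algebra_simps)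
  also have "(1 - x) * Bernstein n 0 x * \<phi> 0 + \<dots> =
      (\<Sum>k=0..n. Bernstein n k x * (x * \<phi> (Suc k))) +
      (\<Sum>k=0..Suc n. Bernstein n k x * ((1 - x) * \<phi> k))"
    unfolding sum.atLeast0_atMost_Suc_shift by (simp add: o_def)
  also have "(\<Sum>k=0..Suc n. Bernstein n k x * ((1 - x) * \<phi> k)) =
      (\<Sum>k=0..n. Bernstein n k x * ((1 - x) * \<phi> k))"
    by (simp add: top)
  finally show ?thesis
    by (simp add: sum.distrib [symmetric] distrib_left)
qed

text \<open>One rewrite rule for all moment computations: a polynomial of degree at most four in
  \<open>c k\<close>, written with all five coefficients, reduces to five power sums.\<close>

lemma sum_Bernstein_quartic:
  fixes a0 a1 a2 a3 a4 :: real
  shows "(\<Sum>k=0..n. Bernstein n k x * (a0 + a1 * c k + a2 * (c k)^2 + a3 * (c k)^3 + a4 * (c k)^4))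
    = a0 * (\<Sum>k=0..n. Bernstein n k x) + a1 * (\<Sum>k=0..n. Bernstein n k x * c k)
    + a2 * (\<Sum>k=0..n. Bernstein n k x * (c k)^2) + a3 * (\<Sum>k=0..n. Bernstein n k x * (c k)^3)
    + a4 * (\<Sum>k=0..n. Bernstein n k x * (c k)^4)"
  by (simp add: sum_distrib_left sum.distrib [symmetric] algebra_simps)

text \<open>Central moments of the binomial distribution; \<open>X\<close> is the variance of a
  single trial. They are proved in one induction because each moment for \<open>Suc n\<close> draws
  on the lower ones for \<open>n\<close>.\<close>

lemma sum_Bernstein_central:
  fixes n :: nat and x X :: real
  defines "X \<equiv> x * (1 - x)"
  shows "(\<Sum>k=0..n. Bernstein n k x) = 1"
    and "(\<Sum>k=0..n. Bernstein n k x * (real k - real n * x)) = 0"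
    and "(\<Sum>k=0..n. Bernstein n k x * (real k - real n * x)^2) = n * X"
    and "(\<Sum>k=0..n. Bernstein n k x * (real k - real n * x)^3) = n * X * (1 - 2 * x)"
    and "(\<Sum>k=0..n. Bernstein n k x * (real k - real n * x)^4) =
           3 * (real n)^2 * X^2 + n * X * (1 - 6 * X)"
proof -
  have "(\<Sum>k=0..n. Bernstein n k x) = 1 \<and>
    (\<Sum>k=0..n. Bernstein n k x * (real k - real n * x)) = 0 \<and>
    (\<Sum>k=0..n. Bernstein n k x * (real k - real n * x)^2) = n * X \<and>
    (\<Sum>k=0..n. Bernstein n k x * (real k - real n * x)^3) = n * X * (1 - 2 * x) \<and>
    (\<Sum>k=0..n. Bernstein n k x * (real k - real n * x)^4) =
           3 * (real n)^2 * X^2 + n * X * (1 - 6 * X)"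
  proof (induction n)
    case 0
    then show ?case by (simp add: Bernstein_def)
  next
    case (Suc n)
    let ?B = "\<lambda>k. Bernstein n k x" and ?c = "\<lambda>k. real k - real n * x"
    \<comment> \<open>The mean moves from \<open>n * x\<close> to \<open>Suc n * x\<close>, so a
      success shifts the deviation \<open>?c k\<close> by \<open>1 - x\<close> and a failure shifts
      it by \<open>- x\<close>.\<close>
    have P: "(\<Sum>k=0..Suc n. Bernstein (Suc n) k x * (real k - real (Suc n) * x)^r) =
        (\<Sum>k=0..n. ?B k * (x * (?c k + (1 - x))^r + (1 - x) * (?c k - x)^r))" for r
      by (subst sum_Bernstein_Suc) (simp add: algebra_simps)
    have P0: "(\<Sum>k=0..Suc n. Bernstein (Suc n) k x) = 1"
      using P [of 0] Suc.IH by simp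
    \<comment> \<open>The terms with coefficient 0 or 1 below give the shape that \<open>sum_Bernstein_quartic\<close> rewrites.\<close>
    have P1: "(\<Sum>k=0..Suc n. Bernstein (Suc n) k x * (real k - real (Suc n) * x)) = 0"
    proof -
      have "x * (c + (1 - x))^1 + (1 - x) * (c - x)^1 = 0 + 1 * c + 0 * c^2 + 0 * c^3 + 0 * c^4"
        for c :: real by algebra
      then show ?thesis using P [of 1] by (simp only: sum_Bernstein_quartic Suc.IH power_one_right)
    qed
    have P2: "(\<Sum>k=0..Suc n. Bernstein (Suc n) k x * (real k - real (Suc n) * x)^2) =
        real (Suc n) * X"
    proof -
      have "x * (c + (1 - x))^2 + (1 - x) * (c - x)^2 = X + 0 * c + 1 * c^2 + 0 * c^3 + 0 * c^4"
        for c :: real unfolding X_def by algebra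
      then show ?thesis unfolding P by (simp only: sum_Bernstein_quartic Suc.IH) (simp add: algebra_simps)
    qed
    have P3: "(\<Sum>k=0..Suc n. Bernstein (Suc n) k x * (real k - real (Suc n) * x)^3) =
        real (Suc n) * X * (1 - 2 * x)"
    proof -
      have "x * (c + (1 - x))^3 + (1 - x) * (c - x)^3 =
          X * (1 - 2 * x) + 3 * X * c + 0 * c^2 + 1 * c^3 + 0 * c^4"
        for c :: real unfolding X_def by algebra
      then show ?thesis unfolding P by (simp only: sum_Bernstein_quartic Suc.IH) (simp add: algebra_simps)
    qed
    have P4: "(\<Sum>k=0..Suc n. Bernstein (Suc n) k x * (real k - real (Suc n) * x)^4) =
        3 * (real (Suc n))^2 * X^2 + real (Suc n) * X * (1 - 6 * X)"
    proof -
      have "x * (c + (1 - x))^4 + (1 - x) * (c - x)^4 =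
          X * (1 - 3 * X) + 4 * X * (1 - 2 * x) * c + 6 * X * c^2 + 0 * c^3 + 1 * c^4"
        for c :: real unfolding X_def by algebra
      then show ?thesis unfolding P
        by (simp only: sum_Bernstein_quartic Suc.IH) (simp add: algebra_simps power2_eq_square)
    qed
    show ?case using P0 P1 P2 P3 P4 by blast
  qed
  then show "(\<Sum>k=0..n. Bernstein n k x) = 1"
    and "(\<Sum>k=0..n. Bernstein n k x * (real k - real n * x)) = 0"
    and "(\<Sum>k=0..n. Bernstein n k x * (real k - real n * x)^2) = n * X"
    and "(\<Sum>k=0..n. Bernstein n k x * (real k - real n * x)^3) = n * X * (1 - 2 * x)"
    and "(\<Sum>k=0..n. Bernstein n k x * (real k - real n * x)^4) =
           3 * (real n)^2 * X^2 + n * X * (1 - 6 * X)"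
    by blast+
qed

section \<open>The Kantorovich operator: linearity, positivity and moments\<close>

lemma kantorovich_interval:
  assumes "k \<le> n"
  shows "real k / (real n + 1) \<le> (real k + 1) / (real n + 1)"
    and "{real k / (real n + 1)..(real k + 1) / (real n + 1)} \<subseteq> {0..1}"
proof -
  show "real k / (real n + 1) \<le> (real k + 1) / (real n + 1)"
    by (intro divide_right_mono) auto
  have "(real k + 1) / (real n + 1) \<le> 1" using assms by simp
  then show "{real k / (real n + 1)..(real k + 1) / (real n + 1)} \<subseteq> {0..1}"
    by (meson atLeastatMost_subset_iff divide_nonneg_nonneg of_nat_0_le_iff add_nonneg_nonneg
        zero_le_one)
qed

lemma kantorovich_integrable:
  fixes h :: "real \<Rightarrow> real"
  assumes "continuous_on {0..1} h" "k \<le> n"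
  shows "h integrable_on {real k / (real n + 1)..(real k + 1) / (real n + 1)}"
  by (intro integrable_continuous_real continuous_on_subset [OF assms(1)]
      kantorovich_interval(2) assms(2))

lemma kantorovich_add:
  assumes "continuous_on {0..1} u" "continuous_on {0..1} v"
  shows "kantorovich n (\<lambda>t. u t + v t) x = kantorovich n u x + kantorovich n v x"
  unfolding kantorovich_def sum.distrib [symmetric]
proof (intro sum.cong refl)
  fix k assume "k \<in> {0..n}"
  then have "k \<le> n" by simp
  note I = kantorovich_integrable [OF _ this]
  show "Bernstein n k x * ((real n + 1) * integral {k / (real n + 1)..(real k + 1) / (real n + 1)} (\<lambda>t. u t + v t)) =
    Bernstein n k x * ((real n + 1) * integral {k / (real n + 1)..(real k + 1) / (real n + 1)} u) +
    Bernstein n k x * ((real n + 1) * integral {k / (real n + 1)..(real k + 1) / (real n + 1)} v)"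
    by (simp only: integral_add [OF I [OF assms(1)] I [OF assms(2)]] distrib_left)
qed

lemma kantorovich_cmult:
  "kantorovich n (\<lambda>t. c * u t) x = c * kantorovich n u x"
  unfolding kantorovich_def by (simp add: sum_distrib_left mult_ac)

lemma kantorovich_mono:
  assumes "continuous_on {0..1} u" "continuous_on {0..1} v"
    and "\<And>t. t \<in> {0..1} \<Longrightarrow> u t \<le> v t" and "x \<in> {0..1}"
  shows "kantorovich n u x \<le> kantorovich n v x"
  unfolding kantorovich_def
proof (intro sum_mono mult_left_mono)
  fix k assume "k \<in> {0..n}"
  then have k: "k \<le> n" by simp
  show "integral {real k / (real n + 1)..(real k + 1) / (real n + 1)} u
      \<le> integral {real k / (real n + 1)..(real k + 1) / (real n + 1)} v"
    by (intro integral_le kantorovich_integrable assms(1-3) k)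
      (rule subsetD [OF kantorovich_interval(2) [OF k]])
  show "0 \<le> Bernstein n k x"
    using assms(4) by (intro Bernstein_nonneg) auto
qed auto

text \<open>Integrating the power over a cell reduces the moments of the operator to those of the
  Bernstein sum: relative to \<open>x\<close>, the cell ends are the deviations
  \<open>k - n * x - x\<close> and \<open>k - n * x + (1 - x)\<close>, both divided by
  \<open>n + 1\<close>.\<close>

lemma kantorovich_power:
  "kantorovich n (\<lambda>t. (t - x)^r) x = 1 / (real n + 1)^r *
     (\<Sum>k=0..n. Bernstein n k x *
       (((real k - real n * x + (1 - x))^Suc r - (real k - real n * x - x)^Suc r) / real (Suc r)))"
  unfolding kantorovich_def sum_distrib_left
proof (intro sum.cong refl)
  fix k assume "k \<in> {0..n}"
  then have k: "k \<le> n" by simp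
  let ?N = "real n + 1"
  let ?a = "real k / ?N" and ?b = "(real k + 1) / ?N"
  let ?c = "real k - real n * x"
  have "((\<lambda>t. (t - x)^r) has_integral (?b - x)^Suc r / real (Suc r) - (?a - x)^Suc r / real (Suc r)) {?a..?b}"
    by (rule fundamental_theorem_of_calculus [OF kantorovich_interval(1) [OF k]])
      (auto intro!: derivative_eq_intros
        simp: has_real_derivative_iff_has_vector_derivative [symmetric]
        simp del: of_nat_Suc power_Suc)
  then have I: "integral {?a..?b} (\<lambda>t. (t - x)^r) =
      (?b - x)^Suc r / real (Suc r) - (?a - x)^Suc r / real (Suc r)"
    by (rule integral_unique)
  have b: "?b - x = (?c + (1 - x)) / ?N" and a: "?a - x = (?c - x) / ?N"
    by (simp_all add: field_simps)
  have alg: "N * (p / (N * M) / R - q / (N * M) / R) = 1 / M * ((p - q) / R)"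
    if "N \<noteq> 0" for N M R p q :: real
    using that by (simp add: right_diff_distrib diff_divide_distrib)
  have "?N * integral {?a..?b} (\<lambda>t. (t - x)^r) =
      1 / ?N^r * (((?c + (1 - x))^Suc r - (?c - x)^Suc r) / real (Suc r))"
    unfolding I a b power_divide power_Suc [of ?N] by (rule alg) simp
  then show "Bernstein n k x * (?N * integral {?a..?b} (\<lambda>t. (t - x)^r)) =
      1 / ?N^r * (Bernstein n k x * (((?c + (1 - x))^Suc r - (?c - x)^Suc r) / real (Suc r)))"
    by (simp only: mult.left_commute)
qed

text \<open>The quotient in \<open>kantorovich_power\<close> is the integral of
  \<open>(c + v)^r\<close> over \<open>v\<close> from \<open>- x\<close> to \<open>1 - x\<close>,
  hence a polynomial of degree \<open>r\<close> in \<open>c\<close>. The coefficients below come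
  from expanding it.\<close>

lemma kantorovich_central_moments:
  fixes n :: nat and x X :: real
  defines "X \<equiv> x * (1 - x)"
  shows "kantorovich n (\<lambda>t. 1) x = 1"
    and "kantorovich n (\<lambda>t. t - x) x = (1 - 2 * x) / (2 * (real n + 1))"
    and "kantorovich n (\<lambda>t. (t - x)^2) x = F_kantorovich n x"
    and "kantorovich n (\<lambda>t. (t - x)^4) x =
           1 / (real n + 1)^4 * (3 * (real n)^2 * X^2 + n * X * (5 - 20 * X) + 1 / 5 - X + X^2)"
proof -
  note E = sum_Bernstein_quartic sum_Bernstein_central [of n x, folded X_def]
  show "kantorovich n (\<lambda>t. 1) x = 1"
    using kantorovich_power [of n x 0] sum_Bernstein_central(1) [of n x] by simp
  have "((c + (1 - x))^Suc 1 - (c - x)^Suc 1) / real (Suc 1) =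
      (1 - 2 * x) / 2 + 1 * c + 0 * c^2 + 0 * c^3 + 0 * c^4" for c
    by (simp add: field_simps power2_eq_square)
  then show "kantorovich n (\<lambda>t. t - x) x = (1 - 2 * x) / (2 * (real n + 1))"
    using kantorovich_power [of n x 1] by (simp only: E power_one_right) simp
  have "((c + (1 - x))^Suc 2 - (c - x)^Suc 2) / real (Suc 2) =
      (1 / 3 - X) + (1 - 2 * x) * c + 1 * c^2 + 0 * c^3 + 0 * c^4" for c
    unfolding X_def by (simp add: field_simps power_numeral_reduce)
  then show "kantorovich n (\<lambda>t. (t - x)^2) x = F_kantorovich n x"
    using kantorovich_power [of n x 2]
    by (simp only: E F_kantorovich_def) (simp add: X_def algebra_simps)
  have "((c + (1 - x))^Suc 4 - (c - x)^Suc 4) / real (Suc 4) =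
      (1 / 5 - X + X^2) + (1 - 2 * x) * (1 - 2 * X) * c + (2 - 6 * X) * c^2
      + 2 * (1 - 2 * x) * c^3 + 1 * c^4" for c
    unfolding X_def by (simp add: field_simps power_numeral_reduce)
  \<comment> \<open>The cubic term contributes the factor \<open>1 - 2 * x\<close> twice; its square
    is again a polynomial in \<open>X\<close>.\<close>
  moreover have "(1 - 2 * x)^2 = 1 - 4 * X"
    unfolding X_def by algebra
  then have "2 * (1 - 2 * x) * (real n * X * (1 - 2 * x)) = 2 * real n * X * (1 - 4 * X)"
    by algebra
  ultimately show "kantorovich n (\<lambda>t. (t - x)^4) x =
      1 / (real n + 1)^4 * (3 * (real n)^2 * X^2 + n * X * (5 - 20 * X) + 1 / 5 - X + X^2)"
    using kantorovich_power [of n x 4] by (simp only: E) (simp add: algebra_simps power2_eq_square)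
qed

lemma mult_one_minus_bounds:
  fixes x :: real
  assumes "x \<in> {0..1}"
  shows "0 \<le> x * (1 - x)" "x * (1 - x) \<le> 1 / 4"
proof -
  show "0 \<le> x * (1 - x)" using assms by simp
  have "0 \<le> (x - 1 / 2)^2" by simp
  then show "x * (1 - x) \<le> 1 / 4" by (simp add: power2_eq_square algebra_simps)
qed

text \<open>As \<open>n - 1\<close> is nonnegative, \<open>x * (1 - x)\<close> may be replaced by
  its maximum \<open>1 / 4\<close>. The second bound says that the second moment is of order
  \<open>1 / (n + 1)\<close>.\<close>

lemma F_kantorovich_bounds:
  assumes "x \<in> {0..1}" "n \<ge> 1"
  shows "0 \<le> F_kantorovich n x" "(real n + 1) * F_kantorovich n x \<le> 1 / 4"
proof -
  note X = mult_one_minus_bounds [OF assms(1)]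
  have n: "real n - 1 \<ge> 0" using assms(2) by simp
  show "0 \<le> F_kantorovich n x"
    unfolding F_kantorovich_def using mult_nonneg_nonneg [OF X(1) n] by simp
  have "x * (1 - x) * (real n - 1) + 1 / 3 \<le> 1 / 4 * (real n - 1) + 1 / 3"
    using mult_right_mono [OF X(2) n] by simp
  also have "\<dots> \<le> 1 / 4 * (real n + 1)" by (simp add: field_simps)
  finally have "x * (1 - x) * (real n - 1) + 1 / 3 \<le> 1 / 4 * (real n + 1)" .
  then show "(real n + 1) * F_kantorovich n x \<le> 1 / 4"
    unfolding F_kantorovich_def by (simp add: power2_eq_square divide_simps)
qed

text \<open>This is the source of the constant \<open>2 * sqrt 6\<close> in the theorem:
  \<open>24 / (n + 1)\<close> is the square of \<open>2 * sqrt 6 / sqrt (n + 1)\<close>.\<close>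

lemma kantorovich_fourth_moment_le:
  assumes "x \<in> {0..1}"
  shows "kantorovich n (\<lambda>t. (t - x)^4) x \<le> 24 / (real n + 1) * F_kantorovich n x"
proof -
  define X where "X = x * (1 - x)"
  have X: "0 \<le> X" "X \<le> 1 / 4"
    unfolding X_def using mult_one_minus_bounds [OF assms] by auto
  let ?N = "real n + 1"
  have X2: "X^2 \<le> 1 / 4 * X"
    using mult_right_mono [OF X(2,1)] by (simp add: power2_eq_square)
  have a: "3 * (real n)^2 * X^2 \<le> 3 / 4 * ((real n)^2 * X)"
    using mult_left_mono [OF X2, of "3 * (real n)^2"] by simp
  have b: "n * X * (5 - 20 * X) \<le> 5 / 4 * n"
  proof -
    have "X * (5 - 20 * X) \<le> X * 5" using X by (intro mult_left_mono) auto
    then have "X * (5 - 20 * X) \<le> 5 / 4" using X by linarith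
    from mult_left_mono [OF this, of "real n"] show ?thesis by (simp add: algebra_simps)
  qed
  have c: "0 \<le> (real n)^2 * X" using X by simp
  have "3 * (real n)^2 * X^2 + n * X * (5 - 20 * X) + 1 / 5 - X + X^2
      \<le> 24 * ((real n)^2 * X) - 24 * X + 8 * ?N"
  proof -
    \<comment> \<open>Here \<open>w\<close> stands for \<open>n^2 * X\<close> and \<open>m\<close>
      for \<open>n\<close>. The negative term \<open>- 24 * X\<close> is at least \<open>- 6\<close>
      and is absorbed by the constant 8.\<close>
    have "p + q + 1 / 5 - X + r \<le> 24 * w - 24 * X + 8 * (m + 1)"
      if "p \<le> 3 / 4 * w" "q \<le> 5 / 4 * m" "0 \<le> w" "r \<le> 1 / 4 * X" "0 \<le> m" for p q r w m
      using that X by simp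
    from this [OF a b c X2] show ?thesis by simp
  qed
  also have "\<dots> = 24 * ?N * (X * (real n - 1) + 1 / 3)"
    by (simp add: algebra_simps power2_eq_square)
  finally have "1 / ?N^4 * (3 * (real n)^2 * X^2 + n * X * (5 - 20 * X) + 1 / 5 - X + X^2)
      \<le> 1 / ?N^4 * (24 * ?N * (X * (real n - 1) + 1 / 3))"
    by (intro mult_left_mono) auto
  also have "\<dots> = 24 / ?N * (1 / ?N^2 * (X * (real n - 1) + 1 / 3))"
    by (simp add: divide_simps) (simp add: power_numeral_reduce algebra_simps)
  finally show ?thesis
    unfolding kantorovich_central_moments F_kantorovich_def X_def .
qed

section \<open>The modulus of continuity\<close>

lemma bdd_above_modulus_of_continuity:
  fixes \<phi> :: "real \<Rightarrow> real"
  assumes "continuous_on {0..1} \<phi>"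
  shows "bdd_above {\<bar>\<phi> u - \<phi> v\<bar> | u v. u \<in> {0..1} \<and> v \<in> {0..1} \<and> \<bar>u - v\<bar> \<le> (\<delta>::real)}"
proof -
  have "bounded (\<phi> ` {0..1})"
    by (intro compact_imp_bounded compact_continuous_image assms) auto
  then obtain M where "\<forall>u\<in>{0..1}. \<bar>\<phi> u\<bar> \<le> M"
    unfolding bounded_iff by auto
  then have M: "\<bar>\<phi> u\<bar> \<le> M" if "u \<in> {0..1}" for u using that by blast
  show ?thesis
  proof (rule bdd_aboveI)
    fix z assume "z \<in> {\<bar>\<phi> u - \<phi> v\<bar> | u v. u \<in> {0..1} \<and> v \<in> {0..1} \<and> \<bar>u - v\<bar> \<le> \<delta>}"
    then obtain u v where "z = \<bar>\<phi> u - \<phi> v\<bar>" "u \<in> {0..1}" "v \<in> {0..1}" by blast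
    then show "z \<le> 2 * M" using M [of u] M [of v] by linarith
  qed
qed

lemma modulus_of_continuity_upper:
  assumes "continuous_on {0..1} \<phi>" "u \<in> {0..1}" "v \<in> {0..1}" "\<bar>u - v\<bar> \<le> \<delta>"
  shows "\<bar>\<phi> u - \<phi> v\<bar> \<le> modulus_of_continuity \<phi> \<delta>"
  unfolding modulus_of_continuity_def
  by (rule cSup_upper [OF _ bdd_above_modulus_of_continuity [OF assms(1)]]) (use assms in blast)

lemma modulus_of_continuity_nonneg:
  assumes "continuous_on {0..1} \<phi>" "0 \<le> \<delta>"
  shows "0 \<le> modulus_of_continuity \<phi> \<delta>"
  using modulus_of_continuity_upper [OF assms(1), of 0 0 \<delta>] assms(2) by simp

text \<open>The segment from \<open>u\<close> to \<open>v\<close> is walked in \<open>m\<close>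
  equal steps, each of length at most \<open>\<delta>\<close>.\<close>

lemma modulus_of_continuity_upper_mult:
  assumes \<phi>: "continuous_on {0..1} \<phi>" and "u \<in> {0..1}" "v \<in> {0..1}"
    and "\<bar>u - v\<bar> \<le> real m * \<delta>"
  shows "\<bar>\<phi> u - \<phi> v\<bar> \<le> real m * modulus_of_continuity \<phi> \<delta>"
  using assms(2-)
proof (induction m arbitrary: u)
  case 0
  then show ?case by simp
next
  case (Suc m)
  \<comment> \<open>The end of the first of \<open>Suc m\<close> equal steps; the rest of the way
    has \<open>m\<close> steps of the same length.\<close>
  define w where "w = u + (v - u) / real (Suc m)"
  have "w = (1 - 1 / real (Suc m)) *\<^sub>R u + (1 / real (Suc m)) *\<^sub>R v"
    unfolding w_def by (simp add: algebra_simps diff_divide_distrib del: of_nat_Suc)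
  then have w: "w \<in> {0..1}"
    using Suc.prems by (simp only:) (intro convexD, auto)
  have "u - w = (u - v) / real (Suc m)" "w - v = real m * ((u - v) / real (Suc m))"
    unfolding w_def by (simp_all add: field_simps)
  moreover have D: "\<bar>u - v\<bar> / real (Suc m) \<le> \<delta>"
    using Suc.prems(3) by (simp add: divide_simps mult.commute del: of_nat_Suc)
  ultimately have "\<bar>u - w\<bar> \<le> \<delta>" "\<bar>w - v\<bar> \<le> real m * \<delta>"
    using mult_left_mono [OF D, of "real m"] by (simp_all add: abs_mult del: of_nat_Suc)
  then have "\<bar>\<phi> u - \<phi> w\<bar> \<le> modulus_of_continuity \<phi> \<delta>"
    and "\<bar>\<phi> w - \<phi> v\<bar> \<le> real m * modulus_of_continuity \<phi> \<delta>"
    using modulus_of_continuity_upper [OF \<phi> _ w] Suc.IH [OF w] Suc.prems by blast+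
  then show ?case by (simp add: algebra_simps)
qed

text \<open>A variant of the usual bound with factor \<open>1 + s / \<delta>\<close>: the fixed
  offset \<open>d\<close> stays inside the modulus, and only the variable part \<open>s\<close>
  enters the factor. Since the factor is linear in \<open>s\<close>, averaging it needs only
  moments.\<close>

lemma modulus_of_continuity_upper_add:
  assumes \<phi>: "continuous_on {0..1} \<phi>" and "u \<in> {0..1}" "v \<in> {0..1}"
    and "\<bar>u - v\<bar> \<le> d + s" "0 \<le> d" "0 \<le> s" "0 < \<delta>"
  shows "\<bar>\<phi> u - \<phi> v\<bar> \<le> (1 + s / \<delta>) * modulus_of_continuity \<phi> (d + \<delta>)"
proof -
  \<comment> \<open>This integer lies between \<open>s / \<delta>\<close> and
    \<open>1 + s / \<delta>\<close>; being at least 1, it also covers \<open>d\<close> by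
    \<open>m * d\<close>.\<close>
  define m where "m = nat \<lfloor>s / \<delta>\<rfloor> + 1"
  have s: "0 \<le> s / \<delta>" using assms by simp
  then have "real m = of_int \<lfloor>s / \<delta>\<rfloor> + 1"
    unfolding m_def by simp
  then have m: "s / \<delta> \<le> real m" "real m \<le> 1 + s / \<delta>"
    by linarith+
  have m1: "1 \<le> real m" unfolding m_def by simp
  from m(1) have "s \<le> real m * \<delta>" using \<open>0 < \<delta>\<close> by (simp add: divide_simps)
  moreover have "d \<le> real m * d" using m1 \<open>0 \<le> d\<close> by (simp add: mult_le_cancel_right1)
  ultimately have "\<bar>u - v\<bar> \<le> real m * (d + \<delta>)"
    using assms(4) by (simp add: distrib_left)
  from modulus_of_continuity_upper_mult [OF \<phi> assms(2,3) this]
  have "\<bar>\<phi> u - \<phi> v\<bar> \<le> real m * modulus_of_continuity \<phi> (d + \<delta>)" .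
  also have "\<dots> \<le> (1 + s / \<delta>) * modulus_of_continuity \<phi> (d + \<delta>)"
    using m(2) assms by (intro mult_right_mono modulus_of_continuity_nonneg) auto
  finally show ?thesis .
qed

section \<open>Twice differentiable functions\<close>

lemma deriv01_has_real_derivative:
  assumes "f differentiable_on {0..1}" "s \<in> {0..1}"
  shows "(f has_real_derivative deriv01 f s) (at s within {0..1})"
proof -
  obtain D where "(f has_real_derivative D) (at s within {0..1})"
    using assms unfolding differentiable_on_def real_differentiable_def by blast
  with deriv01_eqI [OF this assms(2)] show ?thesis by simp
qed

lemma C2_on_01_derivs:
  assumes "C2_on_01 f" "s \<in> {0..1}"
  shows "(f has_real_derivative deriv01 f s) (at s within {0..1})"
    and "(deriv01 f has_real_derivative deriv01 (deriv01 f) s) (at s within {0..1})"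
  using assms deriv01_has_real_derivative unfolding C2_on_01_def by blast+

lemma C2_on_01_continuous:
  assumes "C2_on_01 f"
  shows "continuous_on {0..1} f" "continuous_on {0..1} (deriv01 f)"
    "continuous_on {0..1} (deriv01 (deriv01 f))"
  using assms unfolding C2_on_01_def by (auto intro: differentiable_imp_continuous_on)

text \<open>Leibniz's rule, applied twice. The mixed term
  \<open>2 * (deriv01 f s * deriv01 g s)\<close> is what produces the products of first derivatives
  in the theorem.\<close>

lemma C2_on_01_mult:
  assumes f: "C2_on_01 f" and g: "C2_on_01 g"
  shows "C2_on_01 (\<lambda>t. f t * g t)"
    and "\<And>s. s \<in> {0..1} \<Longrightarrow> deriv01 (deriv01 (\<lambda>t. f t * g t)) s =
      deriv01 (deriv01 f) s * g s + 2 * (deriv01 f s * deriv01 g s) + f s * deriv01 (deriv01 g) s"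
proof -
  let ?h = "\<lambda>t. f t * g t"
  let ?h2 = "\<lambda>s. deriv01 (deriv01 f) s * g s + 2 * (deriv01 f s * deriv01 g s)
      + f s * deriv01 (deriv01 g) s"
  note d = C2_on_01_derivs [OF f] C2_on_01_derivs [OF g]
  have d1: "(?h has_real_derivative deriv01 f s * g s + f s * deriv01 g s) (at s within {0..1})"
    if "s \<in> {0..1}" for s
    using that by (auto intro!: derivative_eq_intros d)
  then have e1: "deriv01 ?h s = deriv01 f s * g s + f s * deriv01 g s" if "s \<in> {0..1}" for s
    using that deriv01_eqI by blast
  have d2: "(deriv01 ?h has_real_derivative ?h2 s) (at s within {0..1})" if s: "s \<in> {0..1}" for s
  proof -
    have "((\<lambda>s. deriv01 f s * g s + f s * deriv01 g s) has_real_derivative ?h2 s) (at s within {0..1})"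
      using s by (auto intro!: derivative_eq_intros d)
    then show ?thesis
      \<comment> \<open>The product formula for \<open>deriv01 ?h\<close> is known only on
        \<open>{0..1}\<close>, so it is exchanged under the derivative within that set.\<close>
      by (rule has_field_derivative_transform_within [OF _ zero_less_one s]) (simp add: e1)
  qed
  show e2: "deriv01 (deriv01 ?h) s = ?h2 s" if "s \<in> {0..1}" for s
    using that d2 deriv01_eqI by blast
  have "?h differentiable_on {0..1}" "deriv01 ?h differentiable_on {0..1}"
    unfolding differentiable_on_def using d1 d2 real_differentiable_def by blast+
  moreover have "continuous_on {0..1} ?h2"
    by (intro continuous_intros C2_on_01_continuous f g)
  then have "continuous_on {0..1} (deriv01 (deriv01 ?h))"
    by (subst continuous_on_cong [OF refl e2])
  ultimately show "C2_on_01 ?h" unfolding C2_on_01_def by blast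
qed

section \<open>Rolle's theorem and the error of linear interpolation\<close>

text \<open>Adapts Rolle's theorem to derivatives within \<open>S\<close>, such as
  \<open>deriv01\<close>, which is one-sided at 0 and 1; strictly between \<open>a\<close> and
  \<open>b\<close> they are ordinary derivatives.\<close>

lemma Rolle_within:
  fixes G :: "real \<Rightarrow> real"
  assumes "a < b" "{a..b} \<subseteq> S" "G a = G b"
    and "\<And>s. s \<in> S \<Longrightarrow> (G has_real_derivative G' s) (at s within S)"
  obtains z where "a < z" "z < b" "G' z = 0"
proof -
  have d: "(G has_real_derivative G' s) (at s within {a..b})" if "s \<in> {a..b}" for s
    using that assms(2,4) DERIV_subset by blast
  have d': "(G has_derivative (\<lambda>h. G' s * h)) (at s)" if "a < s" "s < b" for s
    using d [of s] that at_within_Icc_at [of a s b] by (simp add: has_field_derivative_def)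
  have "continuous_on {a..b} G"
    using d by (meson DERIV_continuous continuous_on_eq_continuous_within)
  from Rolle_deriv [OF assms(1,3) this d'] obtain z
    where z: "a < z" "z < b" "(\<lambda>h. G' z * h) = (\<lambda>v. 0)" by blast
  from fun_cong [OF z(3), of 1] z(1,2) show ?thesis by (intro that [of z]) auto
qed

text \<open>Each of the two gaps between the zeros of \<open>G\<close> contains a zero of
  \<open>G'\<close>, and between these lies a zero of \<open>G''\<close>.\<close>

lemma Rolle_second:
  fixes G :: "real \<Rightarrow> real"
  assumes "a < b" "b < c" "{a..c} \<subseteq> S" "G a = 0" "G b = 0" "G c = 0"
    and G': "\<And>s. s \<in> S \<Longrightarrow> (G has_real_derivative G' s) (at s within S)"
    and G'': "\<And>s. s \<in> S \<Longrightarrow> (G' has_real_derivative G'' s) (at s within S)"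
  obtains z where "a < z" "z < c" "G'' z = 0"
proof -
  have "{a..b} \<subseteq> S" "{b..c} \<subseteq> S" using assms by auto
  then obtain u v where uv: "a < u" "u < b" "b < v" "v < c" "G' u = 0" "G' v = 0"
    using Rolle_within [of a b S G G'] Rolle_within [of b c S G G'] assms by metis
  then have "{u..v} \<subseteq> S" using assms by auto
  then obtain z where "u < z" "z < v" "G'' z = 0"
    using Rolle_within [of u v S G' G''] uv G'' by force
  with uv show ?thesis by (intro that [of z]) auto
qed

text \<open>The classical error formula for interpolation at \<open>x\<close> and \<open>y\<close>.
  The point \<open>z\<close> depends on \<open>t\<close> but stays between the extreme ones of
  \<open>x\<close>, \<open>y\<close>, \<open>t\<close>, which bounds its distance from
  \<open>x\<close>.\<close>

lemma second_order_interpolation: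
  assumes h: "C2_on_01 h" and "x \<in> {0..1}" "y \<in> {0..1}" "t \<in> {0..1}" "x \<noteq> y"
  obtains z where "z \<in> {0..1}" "\<bar>z - x\<bar> \<le> \<bar>x - y\<bar> + \<bar>t - x\<bar>"
    "h t = h x + (t - x) * divided_difference x y h + (t - x) * (t - y) * (deriv01 (deriv01 h) z / 2)"
proof -
  define A where "A = divided_difference x y h"
  have hy: "h y = h x + (y - x) * A"
    using assms(5) unfolding A_def divided_difference_def by (simp add: field_simps)
  show ?thesis
  proof (cases "t = x \<or> t = y")
    case True
    \<comment> \<open>At a node the error term vanishes, so any admissible \<open>z\<close>
      works.\<close>
    then show ?thesis using that [of x] hy assms by (auto simp: A_def)
  next
    case False
    \<comment> \<open>Chosen so that \<open>G\<close> vanishes at \<open>t\<close> as well as at the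
      nodes.\<close>
    define C where "C = (h t - h x - (t - x) * A) / ((t - x) * (t - y))"
    define G where "G = (\<lambda>s. h s - h x - (s - x) * A - C * ((s - x) * (s - y)))"
    define G' where "G' = (\<lambda>s. deriv01 h s - A - C * ((s - x) + (s - y)))"
    define G'' where "G'' = (\<lambda>s. deriv01 (deriv01 h) s - 2 * C)"
    have Ct: "C * ((t - x) * (t - y)) = h t - h x - (t - x) * A"
      using False unfolding C_def by simp
    have zeros: "G x = 0" "G y = 0" "G t = 0"
      unfolding G_def using hy Ct by auto
    note d = C2_on_01_derivs [OF h]
    have G': "(G has_real_derivative G' s) (at s within {0..1})" if "s \<in> {0..1}" for s
      unfolding G_def G'_def using that
      by (auto intro!: derivative_eq_intros d simp: algebra_simps)
    have G'': "(G' has_real_derivative G'' s) (at s within {0..1})" if "s \<in> {0..1}" for s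
      unfolding G'_def G''_def using that
      by (auto intro!: derivative_eq_intros d simp: algebra_simps)
    obtain a b c where abc: "a < b" "b < c" "{a, b, c} = {x, y, t}"
    proof -
      consider "x < y \<and> y < t" | "x < t \<and> t < y" | "y < x \<and> x < t" | "y < t \<and> t < x"
        | "t < x \<and> x < y" | "t < y \<and> y < x"
        using False assms(5) by linarith
      then show ?thesis
        by cases (use that in \<open>metis insert_commute\<close>)+
    qed
    then have "{a, b, c} \<subseteq> {0..1}" "G a = 0" "G b = 0" "G c = 0"
      using assms zeros by auto
    moreover from this have "{a..c} \<subseteq> {0..1}" by auto
    ultimately obtain z where z: "a < z" "z < c" "G'' z = 0" "z \<in> {0..1}"
      using Rolle_second [of a b c "{0..1}" G G' G''] abc(1,2) G' G'' by force
    have "\<bar>z - x\<bar> \<le> \<bar>x - y\<bar> + \<bar>t - x\<bar>"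
    proof -
      have "a \<in> {x, y, t}" "c \<in> {x, y, t}" using abc(3) by blast+
      then show ?thesis using z(1,2) by auto
    qed
    moreover have "C = deriv01 (deriv01 h) z / 2" using z(3) unfolding G''_def by simp
    moreover have "h t = h x + (t - x) * A + (t - x) * (t - y) * C" using Ct by algebra
    ultimately show ?thesis
      using that [OF z(4)] unfolding A_def by simp
  qed
qed

section \<open>The second-order expansion of the operator\<close>

text \<open>Complete the square in \<open>2 * N * \<bar>s\<bar> - 1\<close>. With
  \<open>N = sqrt (n + 1)\<close> both summands are of order \<open>1 / N\<close> after
  averaging.\<close>

lemma abs_le_weighted_square:
  fixes s :: real
  assumes "0 < N"
  shows "\<bar>s\<bar> \<le> N * s^2 + 1 / (4 * N)"
proof -
  have "0 \<le> (2 * N * \<bar>s\<bar> - 1)^2 / (4 * N)" using assms by simp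
  also have "\<dots> = N * s^2 + 1 / (4 * N) - \<bar>s\<bar>"
    using assms by (simp add: power2_diff power_mult_distrib field_simps) (simp add: power2_eq_square)
  finally show ?thesis by simp
qed

text \<open>Complete the square in \<open>\<bar>s\<bar> / \<delta> - 1\<close> and multiply by
  \<open>s^2\<close>; the third absolute moment is thus traded for the second and fourth.\<close>

lemma abs_cube_le:
  fixes s :: real
  assumes "0 < \<delta>"
  shows "\<bar>s\<bar>^3 / \<delta> \<le> s^2 / 2 + s^4 / (2 * \<delta>^2)"
proof -
  have "\<bar>s\<bar>^2 * 0 \<le> \<bar>s\<bar>^2 * ((\<bar>s\<bar> / \<delta> - 1)^2 / 2)" by (intro mult_left_mono) auto
  also have "\<dots> = \<bar>s\<bar>^2 / 2 + \<bar>s\<bar>^4 / (2 * \<delta>^2) - \<bar>s\<bar>^3 / \<delta>"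
    using assms by (simp add: field_simps power_numeral_reduce)
  finally show ?thesis by simp
qed

text \<open>The interpolation remainder \<open>q\<close> is bounded pointwise by
  \<open>\<omega> / 2 * P\<close>, positivity carries this bound over to the operator, and the
  moments bound the value at \<open>P\<close>.\<close>

lemma kantorovich_expansion:
  fixes h :: "real \<Rightarrow> real" and n :: nat and x y :: real
  assumes h: "C2_on_01 h" and n: "n \<ge> 1" and x: "x \<in> {0..1}" and y: "y \<in> {0..1}" "x \<noteq> y"
  shows "\<bar>kantorovich n h x - h x - (1 - 2 * x) / (2 * (real n + 1)) * divided_difference x y h
        - deriv01 (deriv01 h) x / 2 *
          (F_kantorovich n x + (x - y) * ((1 - 2 * x) / (2 * (real n + 1))))\<bar>
    \<le> (F_kantorovich n x + \<bar>x - y\<bar> * (1 / (sqrt 3 * sqrt (real n + 1)))) *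
       modulus_of_continuity (deriv01 (deriv01 h)) (\<bar>x - y\<bar> + 2 * sqrt 6 / sqrt (real n + 1))"
    (is "\<bar>?R\<bar> \<le> _ * ?\<omega>")
proof -
  define N where "N = sqrt (real n + 1)"
  define \<delta> where "\<delta> = 2 * sqrt 6 / N"
  define d where "d = \<bar>x - y\<bar>"
  define A where "A = divided_difference x y h"
  define B where "B = deriv01 (deriv01 h) x / 2"
  define \<omega> where "\<omega> = modulus_of_continuity (deriv01 (deriv01 h)) (d + \<delta>)"
  define F where "F = F_kantorovich n x"
  define M1 where "M1 = (1 - 2 * x) / (2 * (real n + 1))"
  define M4 where "M4 = kantorovich n (\<lambda>t. (t - x)^4) x"
  \<comment> \<open>The quadratic \<open>(t - x) * (t - y)\<close> is split as
    \<open>(t - x)^2 + (x - y) * (t - x)\<close>. The nested sum with \<open>* 1\<close> lets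
    linearity act by plain rewriting.\<close>
  define q where "q = (\<lambda>t. h t + (- (h x) * 1 + (- (A + B * (x - y)) * (t - x) + - B * (t - x)^2)))"
  \<comment> \<open>By AM-GM, \<open>P\<close> dominates \<open>(s\<^sup>2 + d s) (1 + s / \<delta>)\<close> for \<open>s = \<bar>t - x\<bar>\<close>; it avoids odd absolute moments.\<close>
  define P where "P = (\<lambda>t. (3 / 2 + d * N + d / \<delta>) * (t - x)^2
      + (d / (4 * N) * 1 + 1 / (2 * \<delta>^2) * (t - x)^4))"
  have N: "0 < N" "N^2 = real n + 1" unfolding N_def by auto
  have \<delta>: "0 < \<delta>" "\<delta>^2 = 24 / (real n + 1)"
    unfolding \<delta>_def using N by (auto simp: power_divide power_mult_distrib)
  have d: "0 \<le> d" unfolding d_def by simp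
  note ch = C2_on_01_continuous [OF h]
  have \<omega>: "0 \<le> \<omega>"
    unfolding \<omega>_def using d \<delta> ch(3) by (intro modulus_of_continuity_nonneg) auto
  have pointwise: "\<bar>q t\<bar> \<le> \<omega> / 2 * P t" if t: "t \<in> {0..1}" for t
  proof -
    define s where "s = \<bar>t - x\<bar>"
    have s: "0 \<le> s" unfolding s_def by simp
    obtain z where z: "z \<in> {0..1}" "\<bar>z - x\<bar> \<le> d + s"
      "h t = h x + (t - x) * A + (t - x) * (t - y) * (deriv01 (deriv01 h) z / 2)"
      using second_order_interpolation [OF h x y(1) t y(2)] unfolding d_def s_def A_def by blast
    have "q t = (t - x) * (t - y) * ((deriv01 (deriv01 h) z - deriv01 (deriv01 h) x) / 2)"
      unfolding q_def z(3) B_def by (simp add: field_simps power2_eq_square)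
    then have "\<bar>q t\<bar> = s * \<bar>t - y\<bar> * (\<bar>deriv01 (deriv01 h) z - deriv01 (deriv01 h) x\<bar> / 2)"
      unfolding s_def by (simp only: abs_mult abs_divide abs_numeral)
    \<comment> \<open>The triangle inequality bounds \<open>\<bar>t - y\<bar>\<close> by
      \<open>s + d\<close>.\<close>
    also have "\<dots> \<le> s * (s + d) * ((1 + s / \<delta>) * \<omega> / 2)"
    proof (intro mult_mono divide_right_mono)
      show "\<bar>deriv01 (deriv01 h) z - deriv01 (deriv01 h) x\<bar> \<le> (1 + s / \<delta>) * \<omega>"
        unfolding \<omega>_def by (rule modulus_of_continuity_upper_add) (use ch z x d s \<delta> in auto)
    qed (use s d in \<open>auto simp: s_def d_def\<close>)
    also have "\<dots> = \<omega> / 2 * (s^2 + d * s + s^3 / \<delta> + d / \<delta> * s^2)"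
      using \<delta> by (simp add: field_simps power_numeral_reduce)
    also have "\<dots> \<le> \<omega> / 2 * P t"
    proof (intro mult_left_mono)
      have "d * s \<le> d * (N * s^2 + 1 / (4 * N))"
        using abs_le_weighted_square [OF N(1), of "t - x"] d
        by (intro mult_left_mono) (simp_all add: s_def)
      moreover have "s^3 / \<delta> \<le> s^2 / 2 + s^4 / (2 * \<delta>^2)"
        using abs_cube_le [OF \<delta>(1), of s] s by simp
      moreover have "P t = (3 / 2 + d * N + d / \<delta>) * s^2
          + (d / (4 * N) * 1 + 1 / (2 * \<delta>^2) * s^4)"
        unfolding P_def s_def by simp
      ultimately show "s^2 + d * s + s^3 / \<delta> + d / \<delta> * s^2 \<le> P t"
        by (simp add: algebra_simps)
    qed (use \<omega> in simp)
    finally show ?thesis .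
  qed
  have cq: "continuous_on {0..1} q" unfolding q_def by (intro continuous_intros ch)
  have cP: "continuous_on {0..1} P" unfolding P_def by (intro continuous_intros)
  have bounds: "q t \<le> \<omega> / 2 * P t" "- (\<omega> / 2) * P t \<le> q t" if "t \<in> {0..1}" for t
    using pointwise [OF that] by linarith+
  have "kantorovich n q x \<le> kantorovich n (\<lambda>t. \<omega> / 2 * P t) x"
    by (intro kantorovich_mono continuous_intros cq cP x bounds)
  moreover have "kantorovich n (\<lambda>t. - (\<omega> / 2) * P t) x \<le> kantorovich n q x"
    by (intro kantorovich_mono continuous_intros cq cP x bounds)
  ultimately have "\<bar>kantorovich n q x\<bar> \<le> \<omega> / 2 * kantorovich n P x"
    unfolding kantorovich_cmult by linarith
  moreover have "kantorovich n q x =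
      kantorovich n h x + (- (h x) * 1 + (- (A + B * (x - y)) * M1 + - B * F))"
    unfolding q_def M1_def F_def kantorovich_central_moments(2,3) [symmetric]
    by (simp only: kantorovich_cmult kantorovich_add [OF ch(1)] kantorovich_add
        kantorovich_central_moments(1) continuous_intros)
  moreover have KP: "kantorovich n P x = (3 / 2 + d * N + d / \<delta>) * F
      + (d / (4 * N) * 1 + 1 / (2 * \<delta>^2) * M4)"
    unfolding P_def M4_def F_def kantorovich_central_moments(3) [symmetric]
    by (simp only: kantorovich_cmult kantorovich_add kantorovich_central_moments(1) continuous_intros)
  moreover have "kantorovich n P x \<le> 2 * (F + d * (1 / (sqrt 3 * N)))"
  proof -
    have F: "0 \<le> F" "N^2 * F \<le> 1 / 4"
      unfolding F_def N using F_kantorovich_bounds [OF x n] by auto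
    \<comment> \<open>The choice of \<open>\<delta>\<close> turns the fourth moment term into at
      most \<open>F / 2\<close>, which completes \<open>3 / 2 * F\<close> to
      \<open>2 * F\<close>.\<close>
    have "M4 \<le> \<delta>^2 * F"
      unfolding M4_def F_def \<delta> by (rule kantorovich_fourth_moment_le [OF x])
    then have "1 / (2 * \<delta>^2) * M4 \<le> F / 2"
      using \<delta>(1) by (simp add: divide_simps mult_ac)
    \<comment> \<open>After multiplication by \<open>N\<close> the left side is at most
      \<open>1/4 + 1/16 + 1/4\<close>, hence below 1, while the right side becomes
      \<open>2 / sqrt 3\<close>, which is at least 1.\<close>
    moreover have "N * F + F / \<delta> + 1 / (4 * N) \<le> 2 * (1 / (sqrt 3 * N))"
    proof -
      have r6: "2 \<le> sqrt 6" by (simp add: real_le_rsqrt)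
      have "sqrt 3 \<le> 2" by (rule real_le_lsqrt) auto
      then have r3: "1 \<le> 2 / sqrt 3" by simp
      have "N * (N * F + F / \<delta> + 1 / (4 * N)) = N^2 * F + N^2 * F / (2 * sqrt 6) + 1 / 4"
        unfolding \<delta>_def using N(1) by (simp add: field_simps power2_eq_square)
      also have "\<dots> \<le> 1 / 4 + (1 / 4) / (2 * 2) + 1 / 4"
        using F r6 by (intro add_mono frac_le mult_mono) auto
      also have "\<dots> \<le> 1" by simp
      also note r3
      finally show ?thesis using N(1) by (simp add: field_simps)
    qed
    from mult_left_mono [OF this d]
    have "d * N * F + d / \<delta> * F + d / (4 * N) \<le> 2 * (d * (1 / (sqrt 3 * N)))"
      by (simp add: algebra_simps)
    ultimately show ?thesis unfolding KP by (simp add: algebra_simps)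
  qed
  then have "\<omega> / 2 * kantorovich n P x \<le> \<omega> / 2 * (2 * (F + d * (1 / (sqrt 3 * N))))"
    using \<omega> by (intro mult_left_mono) auto
  ultimately have "\<bar>kantorovich n h x - h x - M1 * A - B * (F + (x - y) * M1)\<bar>
      \<le> (F + d * (1 / (sqrt 3 * N))) * \<omega>"
    by (simp add: algebra_simps)
  then show ?thesis
    unfolding A_def B_def M1_def F_def d_def \<omega>_def \<delta>_def N_def .
qed

section \<open>From the expansion to the estimate for products\<close>

lemma abs_le_sup_norm01:
  assumes "continuous_on {0..1} f" "x \<in> {0..1}"
  shows "\<bar>f x\<bar> \<le> sup_norm01 f"
proof -
  have "compact ((\<lambda>t. \<bar>f t\<bar>) ` {0..1})"
    by (intro compact_continuous_image continuous_intros assms) auto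
  then have "bdd_above ((\<lambda>t. \<bar>f t\<bar>) ` {0..1})"
    by (intro bounded_imp_bdd_above compact_imp_bounded)
  then show ?thesis unfolding sup_norm01_def by (rule cSUP_upper [OF assms(2)])
qed

theorem theorem2p1:
  fixes f g :: "real \<Rightarrow> real" and n :: nat and x y :: real
  assumes "C2_on_01 f" and "C2_on_01 g"
    and "n \<ge> 1"
    and "x \<in> {0..1}" and "y \<in> {0..1}" and "x \<noteq> y"
  shows
    "\<bar>kantorovich n (\<lambda>t. f t * g t) x - kantorovich n f x * kantorovich n g x
        + (x - y) * ((1 - 2 * x) / (2 * (real n + 1)))
            * (divided_difference x y f * divided_difference x y g - deriv01 f x * deriv01 g x)
        - F_kantorovich n x * deriv01 f x * deriv01 g x\<bar>
     \<le> (1 / (real n + 1)^2 * (x * (1 - x) * (real n - 1) + 1 / 3)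
          + \<bar>x - y\<bar> * (1 / (sqrt 3 * sqrt (real n + 1))))
       * (modulus_of_continuity (deriv01 (deriv01 (\<lambda>t. f t * g t)))
            (\<bar>x - y\<bar> + 2 * sqrt 6 / sqrt (real n + 1))
          + sup_norm01 g * modulus_of_continuity (deriv01 (deriv01 f))
            (\<bar>x - y\<bar> + 2 * sqrt 6 / sqrt (real n + 1))
          + sup_norm01 f * modulus_of_continuity (deriv01 (deriv01 g))
            (\<bar>x - y\<bar> + 2 * sqrt 6 / sqrt (real n + 1)))
       + \<bar>kantorovich n f x - f x\<bar> * \<bar>kantorovich n g x - g x\<bar>"
proof -
  define K where "K = (\<lambda>h. kantorovich n h x)"
  define F where "F = F_kantorovich n x"
  define M where "M = (1 - 2 * x) / (2 * (real n + 1))"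
  define \<eta> where "\<eta> = F + \<bar>x - y\<bar> * (1 / (sqrt 3 * sqrt (real n + 1)))"
  define \<omega> where "\<omega> = (\<lambda>h. modulus_of_continuity (deriv01 (deriv01 h))
      (\<bar>x - y\<bar> + 2 * sqrt 6 / sqrt (real n + 1)))"
  define R where "R = (\<lambda>h. K h - h x - M * divided_difference x y h
      - deriv01 (deriv01 h) x / 2 * (F + (x - y) * M))"
  let ?h = "\<lambda>t. f t * g t"
  have R: "\<bar>R h\<bar> \<le> \<eta> * \<omega> h" if "C2_on_01 h" for h
    using kantorovich_expansion [OF that assms(3-6)]
    unfolding R_def K_def M_def F_def \<eta>_def \<omega>_def .
  note h = C2_on_01_mult [OF assms(1,2)]
  \<comment> \<open>Leibniz's rule for divided differences; its correction term, times
    \<open>M\<close>, gives the product of divided differences in the theorem.\<close>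
  have dd: "divided_difference x y ?h = f x * divided_difference x y g + g x * divided_difference x y f
      - (x - y) * (divided_difference x y f * divided_difference x y g)"
  proof -
    define A B where "A = divided_difference x y f" and "B = divided_difference x y g"
    have "f y = f x - (x - y) * A" "g y = g x - (x - y) * B"
      using assms(6) unfolding A_def B_def divided_difference_def by simp_all
    then have "f x * g x - f y * g y = (f x * B + g x * A - (x - y) * (A * B)) * (x - y)"
      by algebra
    then show ?thesis
      using assms(6) unfolding A_def [symmetric] B_def [symmetric]
      by (simp add: divided_difference_def)
  qed
  \<comment> \<open>In \<open>R ?h - g x * R f - f x * R g\<close> the single divided differences
    and the terms with second derivatives of \<open>f\<close> and \<open>g\<close> cancel. What is
    left are the product of divided differences and
    \<open>deriv01 f x * deriv01 g x * (F + (x - y) * M)\<close>.\<close>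
  have E: "K ?h - K f * K g
        + (x - y) * M * (divided_difference x y f * divided_difference x y g - deriv01 f x * deriv01 g x)
        - F * deriv01 f x * deriv01 g x =
      R ?h - g x * R f - f x * R g - (K f - f x) * (K g - g x)"
    unfolding R_def dd h(2) [OF assms(4)] by (simp add: field_simps)
  have "\<bar>g x * R f\<bar> \<le> sup_norm01 g * (\<eta> * \<omega> f)" "\<bar>f x * R g\<bar> \<le> sup_norm01 f * (\<eta> * \<omega> g)"
    unfolding abs_mult
    by (intro mult_mono' R abs_le_sup_norm01 C2_on_01_continuous assms abs_ge_zero)+
  moreover have "\<bar>(K f - f x) * (K g - g x)\<bar> = \<bar>K f - f x\<bar> * \<bar>K g - g x\<bar>"
    by (rule abs_mult)
  ultimately have "\<bar>R ?h - g x * R f - f x * R g - (K f - f x) * (K g - g x)\<bar>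
      \<le> \<eta> * \<omega> ?h + sup_norm01 g * (\<eta> * \<omega> f) + sup_norm01 f * (\<eta> * \<omega> g)
        + \<bar>K f - f x\<bar> * \<bar>K g - g x\<bar>"
    using R [OF h(1)] by linarith
  also have "\<dots> = \<eta> * (\<omega> ?h + sup_norm01 g * \<omega> f + sup_norm01 f * \<omega> g)
        + \<bar>K f - f x\<bar> * \<bar>K g - g x\<bar>"
    by (simp add: algebra_simps)
  finally show ?thesis
    unfolding E [symmetric] unfolding K_def M_def F_def \<eta>_def \<omega>_def F_kantorovich_def .
qed

end
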